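(* Let $(\mathfrak g,\varphi_i,\xi_i,\eta_i)$ be an almost $3$-contact Lie algebra with abelian structure. Then the vertical subspace $\mathfrak v$ is a subalgebra of $\mathfrak g$ if and only if $\mathcal Z=0$, in which case either $\mathfrak v$ is abelian or isomorphic to $\mathfrak{so}(3)$, according to $\delta=0$ or $\delta\neq0$ respectively.
   Context: An almost contact structure on a real Lie algebra $\mathfrak g$ is a triple $(\varphi,\xi,\eta)$, $\varphi\in\mathrm{End}(\mathfrak g)$, $\xi\in\mathfrak g$, $\eta\in\mathfrak g^*$, with $\varphi^2=-I+\eta\otimes\xi$ and $\eta(\xi)=1$. It is abelian if $\mathrm{ad}_\xi\circ\varphi=\varphi\circ\mathrm{ad}_\xi$ and $[\varphi X,\varphi Y]=[X,Y]$ for all $X,Y\in\operatorname{Ker}\eta$. An almost $3$-contact Lie algebra is a real Lie algebra $\mathfrak g$ of dimension $4n+3$ with three almost contact structures $(\varphi_i,\xi_i,\eta_i)$, $i=1,2,3$, such that for every even permutation $(i,j,k)$ of $(1,2,3)$: $\varphi_k=\varphi_i\varphi_j-\eta_j\otimes\xi_i=-\varphi_j\varphi_i+\eta_i\otimes\xi_j$, $\xi_k=\varphi_i\xi_j=-\varphi_j\xi_i$, $\eta_k=\eta_i\circ\varphi_j=-\eta_j\circ\varphi_i$. It is abelian if each $(\varphi_i,\xi_i,\eta_i)$ is abelian. The vertical subspace is $\mathfrak v=\langle\xi_1,\xi_2,\xi_3\rangle$. For an abelian structure the following are well defined, independently of the even permutation $(i,j,k)$ of $(1,2,3)$: $\mathcal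 Z:=\varphi_i([\xi_j,\xi_k])\in\bigcap_{r}\operatorname{Ker}\eta_r$, and $\delta\in\mathbb R$ with $2\delta=\eta_i([\xi_j,\xi_k])$. *)

theory Defs
  imports "HOL-Analysis.Analysis"
begin

text \<open>A Lie algebra is carried by a whole type of class \<open>real_vector\<close>; its bracket is an
  explicit parameter. Subalgebras, and the target of an isomorphism, are subsets of such a type.\<close>

locale real_lie_algebra =
  fixes br :: "'a::real_vector \<Rightarrow> 'a \<Rightarrow> 'a"
  assumes bilinear: "bilinear br"
    and alternating: "br x x = 0"
    and jacobi: "br x (br y z) + br y (br z x) + br z (br x y) = 0"

definition lie_subalgebra :: "('a::real_vector \<Rightarrow> 'a \<Rightarrow> 'a) \<Rightarrow> 'a set \<Rightarrow> bool" where
  "lie_subalgebra br S \<longleftrightarrow> subspace S \<and> (\<forall>x\<in>S. \<forall>y\<in>S. br x y \<in> S)"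

definition lie_abelian :: "('a::real_vector \<Rightarrow> 'a \<Rightarrow> 'a) \<Rightarrow> 'a set \<Rightarrow> bool" where
  "lie_abelian br S \<longleftrightarrow> (\<forall>x\<in>S. \<forall>y\<in>S. br x y = 0)"

definition lie_isomorphic ::
  "('a::real_vector \<Rightarrow> 'a \<Rightarrow> 'a) \<Rightarrow> 'a set \<Rightarrow> ('b::real_vector \<Rightarrow> 'b \<Rightarrow> 'b) \<Rightarrow> 'b set \<Rightarrow> bool" where
  "lie_isomorphic br S br' T \<longleftrightarrow>
     (\<exists>f. bij_betw f S T \<and>
          (\<forall>x\<in>S. \<forall>y\<in>S. f (x + y) = f x + f y) \<and>
          (\<forall>c. \<forall>x\<in>S. f (c *\<^sub>R x) = c *\<^sub>R f x) \<and>
          (\<forall>x\<in>S. \<forall>y\<in>S. f (br x y) = br' (f x) (f y)))"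

definition so3 :: "(real^3^3) set" where
  "so3 = {A. transpose A = - A}"

definition commutator :: "real^'n^'n \<Rightarrow> real^'n^'n \<Rightarrow> real^'n^'n" where
  "commutator A B = A ** B - B ** A"

definition almost_contact ::
  "('a::real_vector \<Rightarrow> 'a) \<Rightarrow> 'a \<Rightarrow> ('a \<Rightarrow> real) \<Rightarrow> bool" where
  "almost_contact \<phi> \<xi> \<eta> \<longleftrightarrow>
     linear \<phi> \<and> linear \<eta> \<and> (\<forall>x. \<phi> (\<phi> x) = - x + \<eta> x *\<^sub>R \<xi>) \<and> \<eta> \<xi> = 1"

definition abelian_contact ::
  "('a::real_vector \<Rightarrow> 'a \<Rightarrow> 'a) \<Rightarrow> ('a \<Rightarrow> 'a) \<Rightarrow> 'a \<Rightarrow> ('a \<Rightarrow> real) \<Rightarrow> bool" where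
  "abelian_contact br \<phi> \<xi> \<eta> \<longleftrightarrow>
     (\<forall>x. br \<xi> (\<phi> x) = \<phi> (br \<xi> x)) \<and>
     (\<forall>x y. \<eta> x = 0 \<longrightarrow> \<eta> y = 0 \<longrightarrow> br (\<phi> x) (\<phi> y) = br x y)"

text \<open>Families of structures are indexed by \<open>nat\<close>; only the indices 1, 2, 3 are used.\<close>

definition even_triple :: "nat \<Rightarrow> nat \<Rightarrow> nat \<Rightarrow> bool" where
  "even_triple i j k \<longleftrightarrow> (\<exists>p. p permutes {1,2,3} \<and> evenperm p \<and> i = p 1 \<and> j = p 2 \<and> k = p 3)"

text \<open>A positive \<open>dim UNIV\<close> forces finite dimension: \<open>dim\<close> is the cardinality of a basis, and
  infinite sets have cardinality 0.\<close>

locale almost_3_contact_lie_algebra = real_lie_algebra br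
  for br :: "'a::real_vector \<Rightarrow> 'a \<Rightarrow> 'a" +
  fixes \<phi> :: "nat \<Rightarrow> 'a \<Rightarrow> 'a" and \<xi> :: "nat \<Rightarrow> 'a" and \<eta> :: "nat \<Rightarrow> 'a \<Rightarrow> real"
  assumes dimension: "\<exists>n. dim (UNIV :: 'a set) = 4 * n + 3"
    and contact: "i \<in> {1,2,3} \<Longrightarrow> almost_contact (\<phi> i) (\<xi> i) (\<eta> i)"
    and phi_comp1: "even_triple i j k \<Longrightarrow> \<phi> k x = \<phi> i (\<phi> j x) - \<eta> j x *\<^sub>R \<xi> i"
    and phi_comp2: "even_triple i j k \<Longrightarrow> \<phi> k x = - \<phi> j (\<phi> i x) + \<eta> i x *\<^sub>R \<xi> j"
    and xi_comp1: "even_triple i j k \<Longrightarrow> \<xi> k = \<phi> i (\<xi> j)"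
    and xi_comp2: "even_triple i j k \<Longrightarrow> \<xi> k = - \<phi> j (\<xi> i)"
    and eta_comp1: "even_triple i j k \<Longrightarrow> \<eta> k x = \<eta> i (\<phi> j x)"
    and eta_comp2: "even_triple i j k \<Longrightarrow> \<eta> k x = - \<eta> j (\<phi> i x)"

locale abelian_almost_3_contact_lie_algebra = almost_3_contact_lie_algebra br \<phi> \<xi> \<eta>
  for br :: "'a::real_vector \<Rightarrow> 'a \<Rightarrow> 'a" and \<phi> \<xi> \<eta> +
  assumes abelian: "i \<in> {1,2,3} \<Longrightarrow> abelian_contact br (\<phi> i) (\<xi> i) (\<eta> i)"

definition vertical :: "(nat \<Rightarrow> 'a::real_vector) \<Rightarrow> 'a set" where
  "vertical \<xi> = span {\<xi> 1, \<xi> 2, \<xi> 3}"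

text \<open>The vector \<open>\<Z>\<close> and the scalar \<open>\<delta>\<close>, defined with the triple \<open>(1,2,3)\<close>. For an abelian
  structure every even permutation gives the same values: see \<open>Z_vec_eq\<close> and \<open>delta_eq\<close> below.\<close>

definition Z_vec ::
  "('a::real_vector \<Rightarrow> 'a \<Rightarrow> 'a) \<Rightarrow> (nat \<Rightarrow> 'a \<Rightarrow> 'a) \<Rightarrow> (nat \<Rightarrow> 'a) \<Rightarrow> 'a" where
  "Z_vec br \<phi> \<xi> = \<phi> 1 (br (\<xi> 2) (\<xi> 3))"

definition delta ::
  "('a::real_vector \<Rightarrow> 'a \<Rightarrow> 'a) \<Rightarrow> (nat \<Rightarrow> 'a) \<Rightarrow> (nat \<Rightarrow> 'a \<Rightarrow> real) \<Rightarrow> real" where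
  "delta br \<xi> \<eta> = \<eta> 1 (br (\<xi> 2) (\<xi> 3)) / 2"

lemma even_triple_iff:
  "even_triple i j k \<longleftrightarrow> (i, j, k) \<in> {(1,2,3), (2,3,1), (3,1,2)}"
proof
  have t: "evenperm (Transposition.transpose a b) \<longleftrightarrow> a = b" for a b :: nat
    by (rule evenperm_swap)
  assume "even_triple i j k"
  then obtain p where p: "p permutes {1,2,3::nat}" "evenperm p" "i = p 1" "j = p 2" "k = p 3"
    by (auto simp: even_triple_def)
  have inj: "p 1 \<noteq> p 2" "p 1 \<noteq> p 3" "p 2 \<noteq> p 3"
    using permutes_inj[OF p(1)] by (auto simp: inj_eq)
  have mem: "p 1 \<in> {1,2,3}" "p 2 \<in> {1,2,3}" "p 3 \<in> {1,2,3}"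
    using permutes_in_image[OF p(1)] by blast+
  have out: "p x = x" if "x \<notin> {1,2,3}" for x
    using p(1) that by (rule permutes_not_in)
  have n: "p \<noteq> Transposition.transpose a b" if "a \<noteq> b" for a b
    using t[of a b] p(2) that by auto
  have e: "p = Transposition.transpose a b"
    if "{a,b,c} = {1,2,3}" "p a = b" "p b = a" "p c = c" "a \<noteq> b" "c \<noteq> a" "c \<noteq> b" for a b c
  proof
    fix x
    show "p x = Transposition.transpose a b x"
      using that out[of x] by (cases "x \<in> {a,b,c}") (auto simp: Transposition.transpose_def)
  qed
  have n1: "\<not> (p 1 = 2 \<and> p 2 = 1 \<and> p 3 = 3)" using e[of 1 2 3] n[of 1 2] by auto
  have n2: "\<not> (p 1 = 3 \<and> p 3 = 1 \<and> p 2 = 2)" using e[of 1 3 2] n[of 1 3] by auto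
  have n3: "\<not> (p 2 = 3 \<and> p 3 = 2 \<and> p 1 = 1)" using e[of 2 3 1] n[of 2 3] by auto
  show "(i, j, k) \<in> {(1,2,3), (2,3,1), (3,1,2)}"
    using inj mem n1 n2 n3 unfolding p(3-5) insert_iff empty_iff prod.inject by metis
next
  assume a: "(i, j, k) \<in> {(1,2,3), (2,3,1), (3,1,2)}"
  have c: "even_triple (p 1) (p 2) (p 3)"
    if "p = Transposition.transpose a b \<circ> Transposition.transpose c d" "a \<noteq> b" "c \<noteq> d" "{a,b,c,d} \<subseteq> {1,2,3}" for p a b c d
  proof -
    have "p permutes {1,2,3}"
      unfolding that(1) using that by (intro permutes_compose permutes_swap_id) auto
    moreover have "evenperm p"
      unfolding that(1) using that
      by (simp add: evenperm_comp permutation_swap_id evenperm_swap)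
    ultimately show ?thesis by (auto simp: even_triple_def)
  qed
  have "even_triple 1 2 3"
    unfolding even_triple_def by (rule exI[of _ id]) (simp add: permutes_id evenperm_id)
  moreover have "even_triple 2 3 1"
    using c[OF refl, of 1 2 2 3] by (simp add: Transposition.transpose_def)
  moreover have "even_triple 3 1 2"
    using c[OF refl, of 2 3 1 2] by (simp add: Transposition.transpose_def)
  ultimately show "even_triple i j k" using a by auto
qed

context abelian_almost_3_contact_lie_algebra
begin

lemma br_skew: "br x y = - br y x"
proof -
  have "br (x + y) (x + y) = br x x + br x y + (br y x + br y y)"
    by (simp add: bilinear_ladd[OF bilinear] bilinear_radd[OF bilinear])
  then have "br x y + br y x = 0" by (simp add: alternating)
  then show ?thesis by (simp add: eq_neg_iff_add_eq_0)
qed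

lemma br_xi_rotate:
  assumes "even_triple i j k"
  shows "br (\<xi> i) (\<xi> j) = \<phi> i (br (\<xi> k) (\<xi> i))"
    and "br (\<xi> k) (\<xi> i) = - \<phi> i (br (\<xi> i) (\<xi> j))"
proof -
  have mem: "i \<in> {1,2,3}" "j \<in> {1,2,3}" "k \<in> {1,2,3}" and kij: "even_triple k i j"
    using assms by (auto simp: even_triple_iff)
  have lin: "linear (\<phi> i)"
    using contact[OF mem(1)] by (simp add: almost_contact_def)
  have comm: "br (\<xi> i) (\<phi> i x) = \<phi> i (br (\<xi> i) x)" for x
    using abelian[OF mem(1)] by (simp add: abelian_contact_def)
  have "br (\<xi> i) (\<xi> k) = \<phi> i (br (\<xi> i) (\<xi> j))"
    using comm[of "\<xi> j"] xi_comp1[OF assms] by simp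
  then show "br (\<xi> k) (\<xi> i) = - \<phi> i (br (\<xi> i) (\<xi> j))"
    using br_skew[of "\<xi> k" "\<xi> i"] by simp
  have "br (\<xi> i) (\<xi> j) = - \<phi> i (br (\<xi> i) (\<xi> k))"
    using comm[of "\<xi> k"] xi_comp2[OF kij] by (simp add: bilinear_rneg[OF bilinear])
  also have "\<dots> = \<phi> i (br (\<xi> k) (\<xi> i))"
    using br_skew[of "\<xi> i" "\<xi> k"] by (simp add: linear_neg[OF lin])
  finally show "br (\<xi> i) (\<xi> j) = \<phi> i (br (\<xi> k) (\<xi> i))" .
qed

lemma eta_phi_self:
  assumes "i \<in> {1,2,3}"
  shows "\<eta> i (\<phi> i x) = 0"
proof -
  have c: "\<phi> i (\<xi> i) = 0" if "i \<in> {1,2,3}" for i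
  proof -
    have l: "linear (\<phi> i)" and s: "\<phi> i (\<phi> i x) = - x + \<eta> i x *\<^sub>R \<xi> i" and o: "\<eta> i (\<xi> i) = 1" for x
      using contact[OF that] by (auto simp: almost_contact_def)
    have z: "\<phi> i (\<phi> i (\<xi> i)) = 0" using s[of "\<xi> i"] o by simp
    then have "0 = - \<phi> i (\<xi> i) + \<eta> i (\<phi> i (\<xi> i)) *\<^sub>R \<xi> i"
      using s[of "\<phi> i (\<xi> i)"] linear_0[OF l] by simp
    then have e: "\<phi> i (\<xi> i) = \<eta> i (\<phi> i (\<xi> i)) *\<^sub>R \<xi> i" by (simp add: eq_neg_iff_add_eq_0)
    define c where "c = \<eta> i (\<phi> i (\<xi> i))"
    have e': "\<phi> i (\<xi> i) = c *\<^sub>R \<xi> i" using e by (simp add: c_def)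
    have "c *\<^sub>R c *\<^sub>R \<xi> i = 0"
      using z unfolding e' by (simp add: linear_cmul[OF l] e')
    then show ?thesis using e' by auto
  qed
  have l: "linear (\<phi> i)" and o: "\<eta> i (\<xi> i) = 1"
    and s: "\<phi> i (\<phi> i x) = - x + \<eta> i x *\<^sub>R \<xi> i" for x
    using contact[OF assms] by (auto simp: almost_contact_def)
  have "\<phi> i (\<phi> i (\<phi> i x)) = - \<phi> i x"
    using s[of x] c[OF assms] by (simp add: linear_add[OF l] linear_neg[OF l] linear_cmul[OF l] linear_diff[OF l])
  then have "\<eta> i (\<phi> i x) *\<^sub>R \<xi> i = 0" using s[of "\<phi> i x"] by simp
  moreover have "\<xi> i \<noteq> 0"
    using o contact[OF assms] linear_0[of "\<eta> i"] by (auto simp: almost_contact_def)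
  ultimately show ?thesis by simp
qed

lemma eta_br_xi:
  assumes "even_triple i j k"
  shows "\<eta> i (br (\<xi> i) (\<xi> j)) = 0" "\<eta> j (br (\<xi> i) (\<xi> j)) = 0"
proof -
  have t: "even_triple j k i" "i \<in> {1,2,3}" "j \<in> {1,2,3}"
    using assms by (auto simp: even_triple_iff)
  show "\<eta> i (br (\<xi> i) (\<xi> j)) = 0"
    unfolding br_xi_rotate(1)[OF assms] by (rule eta_phi_self[OF t(2)])
  have "linear (\<eta> j)" using contact[OF t(3)] by (simp add: almost_contact_def)
  then show "\<eta> j (br (\<xi> i) (\<xi> j)) = 0"
    unfolding br_xi_rotate(2)[OF t(1)] by (simp add: linear_neg eta_phi_self[OF t(3)])
qed

lemma phi_br_rotate:
  assumes "even_triple i j k"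
  shows "\<phi> j (br (\<xi> k) (\<xi> i)) = \<phi> i (br (\<xi> j) (\<xi> k))"
    and "\<eta> j (br (\<xi> k) (\<xi> i)) = \<eta> i (br (\<xi> j) (\<xi> k))"
proof -
  have t: "even_triple j k i" "even_triple k i j"
    using assms by (auto simp: even_triple_iff)
  have r: "br (\<xi> k) (\<xi> i) = \<phi> k (br (\<xi> j) (\<xi> k))"
    by (rule br_xi_rotate(1)[OF t(2)])
  show "\<phi> j (br (\<xi> k) (\<xi> i)) = \<phi> i (br (\<xi> j) (\<xi> k))"
    unfolding r phi_comp1[OF t(1)] eta_br_xi(2)[OF t(1)] by simp
  show "\<eta> j (br (\<xi> k) (\<xi> i)) = \<eta> i (br (\<xi> j) (\<xi> k))"
    using eta_comp1[OF t(1), of "br (\<xi> j) (\<xi> k)"] r by simp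
qed

lemma Z_vec_eq: "even_triple i j k \<Longrightarrow> \<phi> i (br (\<xi> j) (\<xi> k)) = Z_vec br \<phi> \<xi>"
proof -
  have t: "even_triple 1 2 3" "even_triple 3 1 2" by (simp_all add: even_triple_iff)
  have 2: "\<phi> 2 (br (\<xi> 3) (\<xi> 1)) = Z_vec br \<phi> \<xi>"
    unfolding Z_vec_def by (rule phi_br_rotate(1)[OF t(1)])
  have 3: "\<phi> 3 (br (\<xi> 1) (\<xi> 2)) = Z_vec br \<phi> \<xi>"
    unfolding Z_vec_def by (rule phi_br_rotate(1)[OF t(2), symmetric])
  assume "even_triple i j k"
  then consider "i = 1" "j = 2" "k = 3" | "i = 2" "j = 3" "k = 1" | "i = 3" "j = 1" "k = 2"
    unfolding even_triple_iff by blast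
  then show ?thesis
    by cases (simp_all only: 2 3 Z_vec_def[symmetric])
qed

lemma delta_eq: "even_triple i j k \<Longrightarrow> \<eta> i (br (\<xi> j) (\<xi> k)) = 2 * delta br \<xi> \<eta>"
proof -
  have t: "even_triple 1 2 3" "even_triple 3 1 2" by (simp_all add: even_triple_iff)
  have 1: "\<eta> 1 (br (\<xi> 2) (\<xi> 3)) = 2 * delta br \<xi> \<eta>"
    by (simp add: delta_def)
  have 2: "\<eta> 2 (br (\<xi> 3) (\<xi> 1)) = 2 * delta br \<xi> \<eta>"
    unfolding 1[symmetric] by (rule phi_br_rotate(2)[OF t(1)])
  have 3: "\<eta> 3 (br (\<xi> 1) (\<xi> 2)) = 2 * delta br \<xi> \<eta>"
    unfolding 1[symmetric] by (rule phi_br_rotate(2)[OF t(2), symmetric])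
  assume "even_triple i j k"
  then consider "i = 1" "j = 2" "k = 3" | "i = 2" "j = 3" "k = 1" | "i = 3" "j = 1" "k = 2"
    unfolding even_triple_iff by blast
  then show ?thesis
    by cases (simp_all only: 1 2 3)
qed

lemma eta_Z_vec:
  assumes "i \<in> {1,2,3}"
  shows "\<eta> i (Z_vec br \<phi> \<xi>) = 0"
proof -
  obtain j k where "even_triple i j k" using assms by (auto simp: even_triple_iff)
  then show ?thesis using eta_phi_self[OF assms] Z_vec_eq by metis
qed

end

end

theory Submission
  imports Defs
begin

text \<open>Applying \<open>\<phi> i\<close> to \<open>\<Z> = \<phi> i [\<xi> j, \<xi> k]\<close> gives
  \<open>[\<xi> j, \<xi> k] = 2 \<delta> \<xi> i - \<phi> i \<Z>\<close>. Hence \<open>\<Z> = 0\<close> makes \<open>\<v>\<close> a subalgebra with the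
  structure constants of \<open>2 \<delta>\<close> times the cross product. Conversely, \<open>\<eta> 2\<close> and \<open>\<eta> 3\<close> vanish
  on \<open>[\<xi> 2, \<xi> 3]\<close>, so if this bracket is vertical it is a multiple of \<open>\<xi> 1\<close>, which
  \<open>\<phi> 1\<close> annihilates.\<close>

text \<open>The matrix of the linear map sending \<open>p\<close> to \<open>cross3 v p\<close>; it
  identifies \<open>real^3\<close> with \<open>so3\<close>.\<close>

definition cross_matrix :: "real^3 \<Rightarrow> real^3^3" where
  "cross_matrix v = vector [vector [0, - v$3, v$2], vector [v$3, 0, - v$1], vector [- v$2, v$1, 0]]"

lemma linear_cross_matrix: "linear cross_matrix"
  by (rule linearI) (simp_all add: cross_matrix_def vec_eq_iff forall_3)

text \<open>As an identity of operators this is the Jacobi identity of the cross product: u x (v x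
  p) - v x (u x p) = (u x v) x p. The check is entrywise.\<close>

lemma commutator_cross_matrix:
  "commutator (cross_matrix u) (cross_matrix v) = cross_matrix (cross3 u v)"
  by (simp add: commutator_def cross_matrix_def cross3_def matrix_matrix_mult_def
      vec_eq_iff forall_3 sum_3)

lemma bij_betw_cross_matrix: "bij_betw cross_matrix UNIV so3"
\<comment> \<open>The inverse reads off the three entries at which \<open>cross_matrix\<close> puts
  a coordinate without a minus sign.\<close>
proof (rule bij_betwI[where g = "\<lambda>A. vector [A$3$2, A$1$3, A$2$1]"])
  show "cross_matrix \<in> UNIV \<rightarrow> so3"
    by (simp add: so3_def cross_matrix_def transpose_def vec_eq_iff forall_3)
  show "cross_matrix (vector [A$3$2, A$1$3, A$2$1]) = A" if "A \<in> so3" for A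
  proof -
    have skew: "A$j$i = - A$i$j" for i j
    proof -
      have "transpose A $ i $ j = (- A) $ i $ j"
        using that unfolding so3_def mem_Collect_eq by (rule arg_cong)
      then show ?thesis
        unfolding transpose_def by simp
    qed
    have "A$i$i = 0" for i
      using skew[of i i] by simp
    \<comment> \<open>The three instances of \<open>skew\<close> rewrite the remaining off-diagonal
      entries in terms of those that the inverse reads.\<close>
    then show ?thesis
      by (simp add: cross_matrix_def vec_eq_iff forall_3 skew[of 2 1] skew[of 1 3] skew[of 3 2])
  qed
qed (simp_all add: cross_matrix_def vec_eq_iff forall_3)

text \<open>Functionals dual to \<open>u\<close>, \<open>v\<close>, \<open>w\<close> recover the
  coefficients of any linear combination of them.\<close>

lemma span_triple_coordinates:
  fixes a b c :: "'a::real_vector \<Rightarrow> real"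
  assumes lin: "linear a" "linear b" "linear c"
    and dual: "a u = 1" "a v = 0" "a w = 0" "b u = 0" "b v = 1" "b w = 0"
      "c u = 0" "c v = 0" "c w = 1"
    and x: "x \<in> span {u, v, w}"
  shows "x = a x *\<^sub>R u + b x *\<^sub>R v + c x *\<^sub>R w"
proof -
  obtain r s t where "x = r *\<^sub>R u + s *\<^sub>R v + t *\<^sub>R w"
  proof -
    \<comment> \<open>Peel the generators off the span one at a time.\<close>
    obtain r where "x - r *\<^sub>R u \<in> span {v, w}"
      using x by (auto simp: span_insert[of u])
    moreover then obtain s where "x - r *\<^sub>R u - s *\<^sub>R v \<in> span {w}"
      by (auto simp: span_insert[of v])
    moreover then obtain t where "x - r *\<^sub>R u - s *\<^sub>R v = t *\<^sub>R w"
      by (auto simp: span_singleton)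
    ultimately show ?thesis
      by (intro that[of r s t]) (simp add: algebra_simps)
  qed
  then show ?thesis
    by (simp add: lin linear_add linear_cmul dual)
qed

text \<open>Repeats \<open>br_skew\<close> in the base locale, since the next lemma concerns
  arbitrary real Lie algebras.\<close>

lemma (in real_lie_algebra) skew: "br x y = - br y x"
proof -
  have "br (x + y) (x + y) = br x x + br x y + (br y x + br y y)"
    by (simp add: bilinear_ladd[OF bilinear] bilinear_radd[OF bilinear])
  then have "br x y + br y x = 0" by (simp add: alternating)
  then show ?thesis by (simp add: eq_neg_iff_add_eq_0)
qed

text \<open>Bilinear expansion leaves nine brackets of generators: three vanish, three are given and
  three follow by skew symmetry. The result is \<open>d\<close> times the cross product of the
  coordinate vectors.\<close>

lemma (in real_lie_algebra) bracket_cross: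
  assumes "br v w = d *\<^sub>R u" "br w u = d *\<^sub>R v" "br u v = d *\<^sub>R w"
  shows "br (r *\<^sub>R u + s *\<^sub>R v + t *\<^sub>R w) (r' *\<^sub>R u + s' *\<^sub>R v + t' *\<^sub>R w) =
    (d * (s * t' - t * s')) *\<^sub>R u + (d * (t * r' - r * t')) *\<^sub>R v + (d * (r * s' - s * r')) *\<^sub>R w"
proof -
  have "br w v = - d *\<^sub>R u" "br u w = - d *\<^sub>R v" "br v u = - d *\<^sub>R w"
    using assms skew[of w v] skew[of u w] skew[of v u] by simp_all
  then show ?thesis
    using assms
    by (simp add: bilinear_ladd[OF bilinear] bilinear_radd[OF bilinear]
        bilinear_lmul[OF bilinear] bilinear_rmul[OF bilinear] alternating algebra_simps)
qed

text \<open>The isomorphism is a rescaled coordinate map onto \<open>real^3\<close> with the cross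
  product, followed by \<open>cross_matrix\<close>.\<close>

lemma (in real_lie_algebra) lie_isomorphic_so3:
  fixes a b c :: "'a \<Rightarrow> real"
  assumes lin: "linear a" "linear b" "linear c"
    and dual: "a u = 1" "a v = 0" "a w = 0" "b u = 0" "b v = 1" "b w = 0"
      "c u = 0" "c v = 0" "c w = 1"
    and br: "br v w = d *\<^sub>R u" "br w u = d *\<^sub>R v" "br u v = d *\<^sub>R w"
    and d: "d \<noteq> 0"
  shows "lie_isomorphic br (span {u, v, w}) commutator so3"
proof -
  \<comment> \<open>The factor \<open>d\<close> absorbs the structure constant: if p and q are the
    coordinate vectors of \<open>x\<close> and \<open>y\<close>, then \<open>br x y\<close> has
    coordinates d (p x q), and d (d (p x q)) = (d p) x (d q).\<close>
  define g :: "'a \<Rightarrow> real^3" where "g x = d *\<^sub>R vector [a x, b x, c x]" for x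
  define h :: "real^3 \<Rightarrow> 'a" where "h p = (p$1 / d) *\<^sub>R u + (p$2 / d) *\<^sub>R v + (p$3 / d) *\<^sub>R w" for p
  note coords = span_triple_coordinates[OF lin dual]
  note lins = lin[THEN linear_add] lin[THEN linear_cmul]
  have lin_g: "linear g"
    by (rule linearI) (simp_all add: g_def lins vec_eq_iff forall_3 algebra_simps)
  have bij_g: "bij_betw g (span {u, v, w}) UNIV"
  proof (rule bij_betwI[where g = h])
    show "h \<in> UNIV \<rightarrow> span {u, v, w}"
      by (auto simp: h_def intro!: span_add span_scale intro: span_base)
    show "h (g x) = x" if "x \<in> span {u, v, w}" for x
      using coords[OF that] d by (simp add: g_def h_def)
    show "g (h p) = p" for p
      using d by (simp add: g_def h_def lins dual vec_eq_iff forall_3)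
  qed simp
  have br_g: "g (br x y) = cross3 (g x) (g y)" if "x \<in> span {u, v, w}" "y \<in> span {u, v, w}" for x y
  proof -
    have br_xy: "br x y = (d * (b x * c y - c x * b y)) *\<^sub>R u + (d * (c x * a y - a x * c y)) *\<^sub>R v
        + (d * (a x * b y - b x * a y)) *\<^sub>R w"
      using bracket_cross[OF br, of "a x" "b x" "c x" "a y" "b y" "c y"]
      by (simp only: coords[OF that(1), symmetric] coords[OF that(2), symmetric])
    show ?thesis
      by (simp add: br_xy g_def lins dual cross3_def vec_eq_iff forall_3 right_diff_distrib mult_ac)
  qed
  show ?thesis
    unfolding lie_isomorphic_def
  proof (intro exI[of _ "cross_matrix \<circ> g"] conjI ballI allI)
    show "bij_betw (cross_matrix \<circ> g) (span {u, v, w}) so3"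
      using bij_g bij_betw_cross_matrix by (rule bij_betw_trans)
  qed (simp_all add: br_g commutator_cross_matrix linear_add[OF lin_g] linear_cmul[OF lin_g]
      linear_add[OF linear_cross_matrix] linear_cmul[OF linear_cross_matrix])
qed

context abelian_almost_3_contact_lie_algebra
begin

lemma linear_phi: "i \<in> {1,2,3} \<Longrightarrow> linear (\<phi> i)"
  and linear_eta: "i \<in> {1,2,3} \<Longrightarrow> linear (\<eta> i)"
  and eta_xi_self: "i \<in> {1,2,3} \<Longrightarrow> \<eta> i (\<xi> i) = 1"
  and phi_phi: "i \<in> {1,2,3} \<Longrightarrow> \<phi> i (\<phi> i x) = - x + \<eta> i x *\<^sub>R \<xi> i"
  using contact[of i] by (simp_all add: almost_contact_def)

lemma phi_xi_self:
  assumes "i \<in> {1,2,3}"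
  shows "\<phi> i (\<xi> i) = 0"
proof -
  have "\<phi> i (\<phi> i (\<xi> i)) = 0"
    by (simp add: phi_phi[OF assms] eta_xi_self[OF assms])
  \<comment> \<open>Since \<open>\<phi> i\<close> maps 0 to 0, the formula for the square of
    \<open>\<phi> i\<close> at \<open>\<phi> i (\<xi> i)\<close> leaves only
    \<open>- \<phi> i (\<xi> i)\<close>, as \<open>\<eta> i\<close> vanishes on the image of
    \<open>\<phi> i\<close>.\<close>
  then show ?thesis
    using phi_phi[OF assms, of "\<phi> i (\<xi> i)"]
    by (simp add: linear_0[OF linear_phi[OF assms]] eta_phi_self[OF assms])
qed

text \<open>Up to sign, \<open>\<xi> k\<close> lies in the image of both \<open>\<phi> i\<close> and
  \<open>\<phi> j\<close>, where \<open>\<eta> i\<close> and \<open>\<eta> j\<close> respectively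
  vanish.\<close>

lemma eta_xi:
  assumes "even_triple i j k"
  shows "\<eta> i (\<xi> k) = 0" "\<eta> j (\<xi> k) = 0"
proof -
  have mem: "i \<in> {1,2,3}" "j \<in> {1,2,3}"
    using assms by (auto simp: even_triple_iff)
  show "\<eta> i (\<xi> k) = 0"
    unfolding xi_comp1[OF assms] by (rule eta_phi_self[OF mem(1)])
  show "\<eta> j (\<xi> k) = 0"
    unfolding xi_comp2[OF assms]
    by (simp add: linear_neg[OF linear_eta[OF mem(2)]] eta_phi_self[OF mem(2)])
qed

lemma br_xi:
  assumes "even_triple i j k"
  shows "br (\<xi> j) (\<xi> k) = (2 * delta br \<xi> \<eta>) *\<^sub>R \<xi> i - \<phi> i (Z_vec br \<phi> \<xi>)"
proof -
  have "i \<in> {1,2,3}"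
    using assms by (auto simp: even_triple_iff)
  from phi_phi[OF this, of "br (\<xi> j) (\<xi> k)"] show ?thesis
    by (simp add: Z_vec_eq[OF assms] delta_eq[OF assms])
qed

lemma eta_xi_dual:
  "\<eta> 1 (\<xi> 1) = 1" "\<eta> 1 (\<xi> 2) = 0" "\<eta> 1 (\<xi> 3) = 0"
  "\<eta> 2 (\<xi> 1) = 0" "\<eta> 2 (\<xi> 2) = 1" "\<eta> 2 (\<xi> 3) = 0"
  "\<eta> 3 (\<xi> 1) = 0" "\<eta> 3 (\<xi> 2) = 0" "\<eta> 3 (\<xi> 3) = 1"
  using eta_xi[of 1 2 3] eta_xi[of 2 3 1] eta_xi[of 3 1 2]
    eta_xi_self[of 1] eta_xi_self[of 2] eta_xi_self[of 3]
  by (simp_all add: even_triple_iff)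

lemma vertical_coordinates:
  assumes "x \<in> vertical \<xi>"
  shows "x = \<eta> 1 x *\<^sub>R \<xi> 1 + \<eta> 2 x *\<^sub>R \<xi> 2 + \<eta> 3 x *\<^sub>R \<xi> 3"
proof (rule span_triple_coordinates)
  show "linear (\<eta> 1)" "linear (\<eta> 2)" "linear (\<eta> 3)"
    by (auto intro: linear_eta)
  show "x \<in> span {\<xi> 1, \<xi> 2, \<xi> 3}"
    using assms by (simp add: vertical_def)
qed (rule eta_xi_dual)+

lemma Z_vec_eq_0_if_subalgebra:
  assumes "lie_subalgebra br (vertical \<xi>)"
  shows "Z_vec br \<phi> \<xi> = 0"
proof -
  have t: "even_triple 2 3 1" and m: "1 \<in> {1,2,3::nat}"
    by (simp_all add: even_triple_iff)
  have "\<xi> 2 \<in> vertical \<xi>" "\<xi> 3 \<in> vertical \<xi>"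
    by (auto simp: vertical_def intro: span_base)
  then have "br (\<xi> 2) (\<xi> 3) \<in> vertical \<xi>"
    using assms by (auto simp: lie_subalgebra_def)
  then have "br (\<xi> 2) (\<xi> 3) = \<eta> 1 (br (\<xi> 2) (\<xi> 3)) *\<^sub>R \<xi> 1"
    using vertical_coordinates[of "br (\<xi> 2) (\<xi> 3)"] eta_br_xi[OF t] by simp
  then have "\<phi> 1 (br (\<xi> 2) (\<xi> 3)) = \<eta> 1 (br (\<xi> 2) (\<xi> 3)) *\<^sub>R \<phi> 1 (\<xi> 1)"
    using linear_cmul[OF linear_phi[OF m]] by metis
  then show ?thesis
    unfolding Z_vec_def phi_xi_self[OF m] by simp
qed

context
  assumes Z_0: "Z_vec br \<phi> \<xi> = 0"
begin

lemma br_xi_Z_0: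
  "br (\<xi> 2) (\<xi> 3) = (2 * delta br \<xi> \<eta>) *\<^sub>R \<xi> 1"
  "br (\<xi> 3) (\<xi> 1) = (2 * delta br \<xi> \<eta>) *\<^sub>R \<xi> 2"
  "br (\<xi> 1) (\<xi> 2) = (2 * delta br \<xi> \<eta>) *\<^sub>R \<xi> 3"
proof -
  have "br (\<xi> j) (\<xi> k) = (2 * delta br \<xi> \<eta>) *\<^sub>R \<xi> i" if "even_triple i j k" for i j k
  proof -
    have "i \<in> {1,2,3}"
      using that by (auto simp: even_triple_iff)
    then show ?thesis
      using br_xi[OF that] by (simp add: Z_0 linear_0[OF linear_phi])
  qed
  then show "br (\<xi> 2) (\<xi> 3) = (2 * delta br \<xi> \<eta>) *\<^sub>R \<xi> 1"
    "br (\<xi> 3) (\<xi> 1) = (2 * delta br \<xi> \<eta>) *\<^sub>R \<xi> 2"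
    "br (\<xi> 1) (\<xi> 2) = (2 * delta br \<xi> \<eta>) *\<^sub>R \<xi> 3"
    by (simp_all add: even_triple_iff)
qed

text \<open>Only the common factor \<open>delta br \<xi> \<eta>\<close> is kept from the cross
  product formula: the shape gives closure of the vertical subspace, and the factor gives
  commutativity when it is 0.\<close>

lemma br_vertical:
  assumes "x \<in> vertical \<xi>" "y \<in> vertical \<xi>"
  obtains r s t where "br x y =
    (delta br \<xi> \<eta> * r) *\<^sub>R \<xi> 1 + (delta br \<xi> \<eta> * s) *\<^sub>R \<xi> 2 + (delta br \<xi> \<eta> * t) *\<^sub>R \<xi> 3"
  using bracket_cross[OF br_xi_Z_0, of "\<eta> 1 x" "\<eta> 2 x" "\<eta> 3 x" "\<eta> 1 y" "\<eta> 2 y" "\<eta> 3 y"]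
  \<comment> \<open>Folding the coordinates back restores \<open>x\<close> and \<open>y\<close>;
    moving the 2 to the right of \<open>delta br \<xi> \<eta>\<close> lets \<open>r\<close>,
    \<open>s\<close>, \<open>t\<close> absorb it.\<close>
  unfolding vertical_coordinates[OF assms(1), symmetric] vertical_coordinates[OF assms(2), symmetric]
    mult.commute[of 2] mult.assoc
  by (rule that)

lemma subalgebra_vertical: "lie_subalgebra br (vertical \<xi>)"
  unfolding lie_subalgebra_def
proof (intro conjI ballI)
  show "subspace (vertical \<xi>)"
    by (simp add: vertical_def)
next
  fix x y assume "x \<in> vertical \<xi>" "y \<in> vertical \<xi>"
  then obtain r s t where "br x y =
      (delta br \<xi> \<eta> * r) *\<^sub>R \<xi> 1 + (delta br \<xi> \<eta> * s) *\<^sub>R \<xi> 2 + (delta br \<xi> \<eta> * t) *\<^sub>R \<xi> 3"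
    by (rule br_vertical)
  then show "br x y \<in> vertical \<xi>"
    by (auto simp: vertical_def intro!: span_add span_scale intro: span_base)
qed

lemma abelian_vertical:
  assumes "delta br \<xi> \<eta> = 0"
  shows "lie_abelian br (vertical \<xi>)"
  unfolding lie_abelian_def
proof (intro ballI)
  fix x y assume "x \<in> vertical \<xi>" "y \<in> vertical \<xi>"
  then show "br x y = 0"
    by (rule br_vertical) (simp add: assms)
qed

lemma vertical_isomorphic_so3:
  assumes "delta br \<xi> \<eta> \<noteq> 0"
  shows "lie_isomorphic br (vertical \<xi>) commutator so3"
  unfolding vertical_def
proof (rule lie_isomorphic_so3)
  show "linear (\<eta> 1)" "linear (\<eta> 2)" "linear (\<eta> 3)"
    by (auto intro: linear_eta)
  show "2 * delta br \<xi> \<eta> \<noteq> 0"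
    using assms by simp
qed (rule eta_xi_dual br_xi_Z_0)+

end

end

theorem proposition4p5:
  fixes br :: "'a::real_vector \<Rightarrow> 'a \<Rightarrow> 'a"
    and \<phi> :: "nat \<Rightarrow> 'a \<Rightarrow> 'a" and \<xi> :: "nat \<Rightarrow> 'a" and \<eta> :: "nat \<Rightarrow> 'a \<Rightarrow> real"
  assumes "abelian_almost_3_contact_lie_algebra br \<phi> \<xi> \<eta>"
  shows "(lie_subalgebra br (vertical \<xi>) \<longleftrightarrow> Z_vec br \<phi> \<xi> = 0) \<and>
    (lie_subalgebra br (vertical \<xi>) \<longrightarrow>
       (delta br \<xi> \<eta> = 0 \<longrightarrow> lie_abelian br (vertical \<xi>)) \<and>
       (delta br \<xi> \<eta> \<noteq> 0 \<longrightarrow> lie_isomorphic br (vertical \<xi>) commutator so3))"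
proof -
  interpret abelian_almost_3_contact_lie_algebra br \<phi> \<xi> \<eta>
    by (rule assms)
  show ?thesis
    using Z_vec_eq_0_if_subalgebra subalgebra_vertical abelian_vertical vertical_isomorphic_so3
    by blast
qed

end
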